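(* Let $G$ be a connected uniform graph, let $r\ge2$ be an integer and let $m\ge0$ be an integer. If for every pair of vertices $a,b$ and every minimal $ab$-$r$-separator $S$ either $S_a$ or $S_b$ has diameter at most $m$, then $G$ satisfies the Bottleneck Property (BP), i.e., $G$ is quasi-isometric to a tree.
   Context: Every edge of the connected graph $G$ has length $1$, interior points of edges are points of $G$, and $d$ is the induced shortest-path (length) metric on $G$, making $G$ a geodesic metric space; $V(G)$ is the vertex set. Diameters are taken with respect to $d$. $G$ is uniform if there is a constant $\mu$ such that every vertex has at most $\mu$ neighbors. Given $r\in\mathbb{N}$, two vertices $a,b$ are $r$-separated by $S\subset V(G)$ (and $S$ is called an $ab$-$r$-separator) if, denoting by $G_a$ and $G_b$ the connected components of $G\setminus S$ containing $a$ and $b$ respectively, $d(v,w)>r$ for every pair of vertices $v\in G_a$, $w\in G_b$. $S$ is a minimal $ab$-$r$-separator if it is an $ab$-$r$-separator and no proper subset of $S$ $r$-separates $a$ and $b$. For $r\ge2$, every minimal $ab$-$r$-separator $S$ is the disjoint union $S=S_a\cup S_b$, where $S_a$ is the set of vertices of $S$ adjacent to $G_a$ and $S_b$ is the set of vertices of $S$ adjacent to $G_b$. A geodesic metric space $(X,d)$ satisfies the Bottleneck Property (BP) if there is a constant $\Delta>0$ such that, given any two distinct points $x,y\in X$ and any midpoint $z$, i.e. $d(x,z)=d(z,y)=\frac12 d(x,y)$, every $xy$-path (path in $X$ joining $x$ to $y$) intersects $N_\Delta(z)=\{w : d(z,w)\le\Delta\}$. (A geodesic metric space satisfies (BP) if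 and only if it is quasi-isometric to a tree, by a theorem of Manning.) A map $f:(X,d_X)\to(Y,d_Y)$ between metric spaces is a quasi-isometry if there are constants $\lambda\ge1$, $C>0$, $D>0$ such that $\frac1\lambda d_X(x,x')-C\le d_Y(f(x),f(x'))\le\lambda d_X(x,x')+C$ for all $x,x'\in X$ and $d_Y(y,f(X))\le D$ for all $y\in Y$; then $X$ and $Y$ are quasi-isometric. *)

theory Defs
  imports "HOL-Analysis.Analysis"
begin

section \<open>Graphs\<close>

text \<open>A (possibly infinite) simple graph is a vertex set \<open>V\<close> together with a set \<open>E\<close> of
  two-element subsets of \<open>V\<close>.\<close>

definition simple_graph :: "'a set \<Rightarrow> 'a set set \<Rightarrow> bool" where
  "simple_graph V E \<longleftrightarrow> E \<subseteq> {{u, v} | u v. u \<in> V \<and> v \<in> V \<and> u \<noteq> v}"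

definition neighbours :: "'a set set \<Rightarrow> 'a \<Rightarrow> 'a set" where
  "neighbours E v = {w. {v, w} \<in> E}"

text \<open>The vertex set of the connected component of \<open>a\<close> in the graph \<open>G \<setminus> S\<close>
  (vertices in \<open>S\<close> deleted with their incident edges); meant for \<open>a \<in> V - S\<close>.\<close>

definition component :: "'a set \<Rightarrow> 'a set set \<Rightarrow> 'a set \<Rightarrow> 'a \<Rightarrow> 'a set" where
  "component V E S a = {v. (a, v) \<in> {(x, y). x \<in> V - S \<and> y \<in> V - S \<and> {x, y} \<in> E}\<^sup>*}"

definition connected_graph :: "'a set \<Rightarrow> 'a set set \<Rightarrow> bool" where
  "connected_graph V E \<longleftrightarrow> simple_graph V E \<and> V \<noteq> {} \<and> (\<forall>a\<in>V. \<forall>b\<in>V. b \<in> component V E {} a)"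

definition uniform_graph :: "'a set \<Rightarrow> 'a set set \<Rightarrow> bool" where
  "uniform_graph V E \<longleftrightarrow>
     (\<exists>\<mu>::nat. \<forall>v\<in>V. finite (neighbours E v) \<and> card (neighbours E v) \<le> \<mu>)"

definition is_cycle :: "'a set set \<Rightarrow> 'a list \<Rightarrow> bool" where
  "is_cycle E vs \<longleftrightarrow> 3 \<le> length vs \<and> distinct vs \<and>
     successively (\<lambda>u v. {u, v} \<in> E) vs \<and> {last vs, hd vs} \<in> E"

definition tree_graph :: "'a set \<Rightarrow> 'a set set \<Rightarrow> bool" where
  "tree_graph V E \<longleftrightarrow> connected_graph V E \<and> (\<nexists>vs. is_cycle E vs)"


section \<open>The metric graph\<close>

text \<open>The points of the geometric realization are given by barycentric coordinates: a vertex \<open>v\<close>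
  is the indicator function of \<open>{v}\<close>, and the point at distance \<open>t\<close> from \<open>u\<close> on the edge
  \<open>{u, v}\<close> has coordinates \<open>1 - t\<close> at \<open>u\<close>, \<open>t\<close> at \<open>v\<close>, and \<open>0\<close> elsewhere.\<close>

definition cells :: "'a set \<Rightarrow> 'a set set \<Rightarrow> 'a set set" where
  "cells V E = E \<union> {{v} | v. v \<in> V}"

definition cell_points :: "'a set \<Rightarrow> ('a \<Rightarrow> real) set" where
  "cell_points e = {p. (\<forall>x. 0 \<le> p x) \<and> (\<forall>x. x \<notin> e \<longrightarrow> p x = 0) \<and> (\<Sum>x\<in>e. p x) = 1}"

definition graph_points :: "'a set \<Rightarrow> 'a set set \<Rightarrow> ('a \<Rightarrow> real) set" where
  "graph_points V E = (\<Union>e\<in>cells V E. cell_points e)"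

definition vertex_point :: "'a \<Rightarrow> 'a \<Rightarrow> real" where
  "vertex_point v = indicat_real {v}"

text \<open>\<open>pl_path V E p q l\<close>: there is a piecewise linear path from \<open>p\<close> to \<open>q\<close> of length \<open>l\<close>.
  For \<open>p\<close>, \<open>q\<close> on a common edge \<open>{u, v}\<close> of length \<open>1\<close> one has
  \<open>\<bar>p u - q u\<bar> = \<bar>p v - q v\<bar>\<close>, and this is the length of the segment between them; halving
  the sum avoids choosing an endpoint. The shortest-path metric is the infimum of the lengths
  (set to \<open>0\<close> off the graph, as the locale \<^locale>\<open>Metric_space\<close> wants a total function).\<close>

inductive pl_path :: "'a set \<Rightarrow> 'a set set \<Rightarrow> ('a \<Rightarrow> real) \<Rightarrow> ('a \<Rightarrow> real) \<Rightarrow> real \<Rightarrow> bool"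
  for V E where
  refl: "p \<in> graph_points V E \<Longrightarrow> pl_path V E p p 0"
| step: "pl_path V E p q l \<Longrightarrow> e \<in> cells V E \<Longrightarrow> q \<in> cell_points e \<Longrightarrow> q' \<in> cell_points e
    \<Longrightarrow> pl_path V E p q' (l + (\<Sum>x\<in>e. \<bar>q x - q' x\<bar>) / 2)"

definition graph_dist :: "'a set \<Rightarrow> 'a set set \<Rightarrow> ('a \<Rightarrow> real) \<Rightarrow> ('a \<Rightarrow> real) \<Rightarrow> real" where
  "graph_dist V E p q =
     (if p \<in> graph_points V E \<and> q \<in> graph_points V E then Inf {l. pl_path V E p q l} else 0)"

definition vertex_dist :: "'a set \<Rightarrow> 'a set set \<Rightarrow> 'a \<Rightarrow> 'a \<Rightarrow> real" where
  "vertex_dist V E v w = graph_dist V E (vertex_point v) (vertex_point w)"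

definition vertex_diam :: "'a set \<Rightarrow> 'a set set \<Rightarrow> 'a set \<Rightarrow> ennreal" where
  "vertex_diam V E A = (SUP v\<in>A. SUP w\<in>A. ennreal (vertex_dist V E v w))"


section \<open>Separators\<close>

definition r_separator ::
    "'a set \<Rightarrow> 'a set set \<Rightarrow> nat \<Rightarrow> 'a \<Rightarrow> 'a \<Rightarrow> 'a set \<Rightarrow> bool" where
  "r_separator V E r a b S \<longleftrightarrow> S \<subseteq> V \<and> a \<in> V - S \<and> b \<in> V - S \<and>
     (\<forall>v\<in>component V E S a. \<forall>w\<in>component V E S b. vertex_dist V E v w > real r)"

definition minimal_r_separator ::
    "'a set \<Rightarrow> 'a set set \<Rightarrow> nat \<Rightarrow> 'a \<Rightarrow> 'a \<Rightarrow> 'a set \<Rightarrow> bool" where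
  "minimal_r_separator V E r a b S \<longleftrightarrow>
     r_separator V E r a b S \<and> (\<forall>T. T \<subset> S \<longrightarrow> \<not> r_separator V E r a b T)"

text \<open>The part \<open>S\<^sub>a\<close> of a separator \<open>S\<close>: the vertices of \<open>S\<close> adjacent to the component of \<open>a\<close>.\<close>

definition separator_side :: "'a set \<Rightarrow> 'a set set \<Rightarrow> 'a set \<Rightarrow> 'a \<Rightarrow> 'a set" where
  "separator_side V E S a = {s \<in> S. \<exists>v\<in>component V E S a. {s, v} \<in> E}"


section \<open>Bottleneck property and quasi-isometries\<close>

definition bottleneck_property :: "'p set \<Rightarrow> ('p \<Rightarrow> 'p \<Rightarrow> real) \<Rightarrow> bool" where
  "bottleneck_property M d \<longleftrightarrow>
     (\<exists>\<Delta>>0. \<forall>x\<in>M. \<forall>y\<in>M. \<forall>z\<in>M. x \<noteq> y \<and> d x z = d x y / 2 \<and> d z y = d x y / 2 \<longrightarrow>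
        (\<forall>g. pathin (Metric_space.mtopology M d) g \<and> g 0 = x \<and> g 1 = y \<longrightarrow>
           (\<exists>t\<in>{0..1}. d z (g t) \<le> \<Delta>)))"

definition quasi_isometry ::
    "'p set \<Rightarrow> ('p \<Rightarrow> 'p \<Rightarrow> real) \<Rightarrow> 'q set \<Rightarrow> ('q \<Rightarrow> 'q \<Rightarrow> real) \<Rightarrow> ('p \<Rightarrow> 'q) \<Rightarrow> bool" where
  "quasi_isometry X dX Y dY f \<longleftrightarrow> f \<in> X \<rightarrow> Y \<and>
     (\<exists>L\<ge>1. \<exists>C>0. \<exists>D>0.
        (\<forall>x\<in>X. \<forall>x'\<in>X. dX x x' / L - C \<le> dY (f x) (f x') \<and> dY (f x) (f x') \<le> L * dX x x' + C) \<and>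
        (\<forall>y\<in>Y. (INF x\<in>X. dY y (f x)) \<le> D))"

text \<open>The vertices of the tree are taken from the vertex type of the graph. This loses nothing:
  a tree quasi-isometric to a graph \<open>G\<close> can be replaced by a single vertex if \<open>G\<close> is finite and,
  if \<open>G\<close> is infinite, by the subtree spanned by the image of \<open>V(G)\<close>, which has at most
  \<open>|V(G)|\<close> vertices.\<close>

definition quasi_isometric_to_tree :: "'a set \<Rightarrow> 'a set set \<Rightarrow> bool" where
  "quasi_isometric_to_tree V E \<longleftrightarrow>
     (\<exists>(V' :: 'a set) E' f. tree_graph V' E' \<and>
        quasi_isometry (graph_points V E) (graph_dist V E)
          (graph_points V' E') (graph_dist V' E') f)"


section \<open>The metric space of a connected graph\<close>

lemma cell_coord_le:
  assumes "finite e" "q \<in> cell_points e" "q' \<in> cell_points e"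
  shows "\<bar>q x - q' x\<bar> \<le> (\<Sum>x\<in>e. \<bar>q x - q' x\<bar>)"
proof (cases "x \<in> e")
  case True
  then show ?thesis using assms(1) member_le_sum[of x e "\<lambda>x. \<bar>q x - q' x\<bar>"] by auto
next
  case False
  then show ?thesis using assms(2,3) by (auto simp: cell_points_def intro: sum_nonneg)
qed

lemma finite_cell: "simple_graph V E \<Longrightarrow> e \<in> cells V E \<Longrightarrow> finite e"
  by (auto simp: simple_graph_def cells_def)

lemma pl_path_points:
  "pl_path V E p q l \<Longrightarrow> p \<in> graph_points V E \<and> q \<in> graph_points V E"
  by (induction rule: pl_path.induct) (auto simp: graph_points_def)

lemma pl_path_nonneg: "pl_path V E p q l \<Longrightarrow> 0 \<le> l"
  by (induction rule: pl_path.induct) (auto intro!: add_nonneg_nonneg sum_nonneg)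

lemma pl_path_coord:
  assumes "simple_graph V E"
  shows "pl_path V E p q l \<Longrightarrow> \<bar>p x - q x\<bar> \<le> 2 * l"
proof (induction rule: pl_path.induct)
  case (step p q l e q')
  show ?case using step.IH cell_coord_le[OF finite_cell[OF assms step.hyps(2)] step.hyps(3,4), of x]
      abs_triangle_ineq[of "p x - q x" "q x - q' x"]
    by simp
qed auto

lemma pl_path_trans:
  assumes "pl_path V E q s l'" "pl_path V E p q l"
  shows "pl_path V E p s (l + l')"
  using assms
proof (induction rule: pl_path.induct)
  case (step q s l' e s')
  from pl_path.step[OF step.IH[OF step.prems] step.hyps(2-4)] show ?case by (simp add: add.assoc)
qed auto

lemma pl_path_sym: "pl_path V E p q l \<Longrightarrow> pl_path V E q p l"
proof (induction rule: pl_path.induct)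
  case (refl p)
  then show ?case by (rule pl_path.refl)
next
  case (step p q l e q')
  have "q' \<in> graph_points V E" using step by (auto simp: graph_points_def)
  from pl_path_trans[OF step.IH pl_path.step[OF pl_path.refl[OF this] step.hyps(2,4,3)]]
  show ?case by (simp add: abs_minus_commute add.commute)
qed

lemma vertex_point_cell: "finite e \<Longrightarrow> v \<in> e \<Longrightarrow> vertex_point v \<in> cell_points e"
  by (auto simp: vertex_point_def cell_points_def indicator_def)

lemma vertex_point_in: "v \<in> V \<Longrightarrow> vertex_point v \<in> graph_points V E"
  using vertex_point_cell[of "{v}" v] by (auto simp: graph_points_def cells_def)

lemma pl_path_exists:
  assumes G: "connected_graph V E" and p: "p \<in> graph_points V E" and q: "q \<in> graph_points V E"
  shows "\<exists>l. pl_path V E p q l"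
proof -
  have sg: "simple_graph V E" using G by (simp add: connected_graph_def)
  have near: "\<exists>v\<in>V. \<exists>l. pl_path V E p (vertex_point v) l" if p: "p \<in> graph_points V E" for p
  proof -
    obtain e where e: "e \<in> cells V E" "p \<in> cell_points e" using p by (auto simp: graph_points_def)
    obtain v where v: "v \<in> e" "v \<in> V" using e(1) sg by (auto simp: cells_def simple_graph_def)
    show ?thesis using pl_path.step[OF pl_path.refl[OF p] e vertex_point_cell] finite_cell[OF sg e(1)] v
      by blast
  qed
  have conn: "\<exists>l. pl_path V E (vertex_point a) (vertex_point b) l"
    if "a \<in> V" "b \<in> V" for a b
  proof -
    have "(a, b) \<in> {(x, y). x \<in> V - {} \<and> y \<in> V - {} \<and> {x, y} \<in> E}\<^sup>*"
      using G that by (auto simp: connected_graph_def component_def)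
    then show ?thesis
    proof (induction rule: rtrancl_induct)
      case base
      then show ?case using pl_path.refl[OF vertex_point_in[OF that(1)]] by blast
    next
      case (step y z)
      then have e: "{y, z} \<in> cells V E" by (auto simp: cells_def)
      from step obtain l where "pl_path V E (vertex_point a) (vertex_point y) l" by blast
      from pl_path.step[OF this e vertex_point_cell vertex_point_cell] show ?case by auto
    qed
  qed
  from near[OF p] obtain v l1 where 1: "v \<in> V" "pl_path V E p (vertex_point v) l1" by blast
  from near[OF q] obtain w l2 where 2: "w \<in> V" "pl_path V E q (vertex_point w) l2" by blast
  from conn[OF 1(1) 2(1)] obtain l3 where 3: "pl_path V E (vertex_point v) (vertex_point w) l3" ..
  show ?thesis using pl_path_trans[OF pl_path_sym[OF 2(2)] pl_path_trans[OF 3 1(2)]] by blast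
qed

lemma graph_dist_le:
  assumes "pl_path V E p q l"
  shows "graph_dist V E p q \<le> l"
proof -
  have "bdd_below {l. pl_path V E p q l}"
    by (rule bdd_belowI[of _ 0]) (auto dest: pl_path_nonneg)
  then show ?thesis
    using assms pl_path_points[OF assms] by (auto simp: graph_dist_def intro: cInf_lower)
qed

lemma graph_dist_approx:
  assumes "connected_graph V E" "p \<in> graph_points V E" "q \<in> graph_points V E" "0 < \<epsilon>"
  obtains l where "pl_path V E p q l" "l < graph_dist V E p q + \<epsilon>"
  using cInf_lessD[of "{l. pl_path V E p q l}" "graph_dist V E p q + \<epsilon>"]
    pl_path_exists[OF assms(1-3)] assms(2-4) by (auto simp: graph_dist_def)

lemma Metric_space_graph:
  assumes G: "connected_graph V E"
  shows "Metric_space (graph_points V E) (graph_dist V E)"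
proof
  have sg: "simple_graph V E" using G by (simp add: connected_graph_def)
  show nonneg: "0 \<le> graph_dist V E x y" for x y
  proof (cases "x \<in> graph_points V E \<and> y \<in> graph_points V E")
    case True
    then have "{l. pl_path V E x y l} \<noteq> {}" using pl_path_exists[OF G] by blast
    then have "0 \<le> Inf {l. pl_path V E x y l}"
      by (rule cInf_greatest) (auto dest: pl_path_nonneg)
    then show ?thesis by (simp add: graph_dist_def)
  qed (auto simp: graph_dist_def)
  show "graph_dist V E x y = graph_dist V E y x" for x y
  proof -
    have "pl_path V E x y = pl_path V E y x" using pl_path_sym by blast
    then show ?thesis by (auto simp: graph_dist_def)
  qed
  show "graph_dist V E x y = 0 \<longleftrightarrow> x = y"
    if xy: "x \<in> graph_points V E" "y \<in> graph_points V E" for x y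
  proof
    assume 0: "graph_dist V E x y = 0"
    have "\<bar>x v - y v\<bar> \<le> 0 + \<epsilon>" if pos: "0 < \<epsilon>" for v \<epsilon>
    proof -
      obtain l where "pl_path V E x y l" "l < graph_dist V E x y + \<epsilon> / 2"
        using graph_dist_approx[OF G xy, of "\<epsilon> / 2"] pos by auto
      then show ?thesis using pl_path_coord[OF sg, of x y l v] 0 by simp
    qed
    then have "\<bar>x v - y v\<bar> \<le> 0" for v by (rule field_le_epsilon)
    then show "x = y" by (auto simp: fun_eq_iff)
  next
    assume "x = y"
    then show "graph_dist V E x y = 0"
      using graph_dist_le[OF pl_path.refl[OF xy(1)]] nonneg[of x x] by simp
  qed
  show "graph_dist V E x z \<le> graph_dist V E x y + graph_dist V E y z"
    if x: "x \<in> graph_points V E" and y: "y \<in> graph_points V E" and z: "z \<in> graph_points V E"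
    for x y z
  proof (rule field_le_epsilon)
    fix \<epsilon> :: real assume "0 < \<epsilon>"
    then obtain l l' where "pl_path V E x y l" "l < graph_dist V E x y + \<epsilon> / 2"
      "pl_path V E y z l'" "l' < graph_dist V E y z + \<epsilon> / 2"
      using graph_dist_approx[OF G x y, of "\<epsilon> / 2"] graph_dist_approx[OF G y z, of "\<epsilon> / 2"]
      by (metis half_gt_zero)
    then show "graph_dist V E x z \<le> graph_dist V E x y + graph_dist V E y z + \<epsilon>"
      using graph_dist_le[OF pl_path_trans] by fastforce
  qed
qed

end

theory Submission
  imports Defs
begin

text \<open>Suppose that \<open>z\<close> lies on a geodesic from \<open>x\<close> to \<open>y\<close> and that another walk from \<open>x\<close> to \<open>y\<close> stays
  far from \<open>z\<close>. The strip of vertices whose distance from \<open>x\<close> is at least \<open>d(x, z)\<close> and less than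
  \<open>d(x, z) + r\<close> is a finite separator of \<open>x\<close> and \<open>y\<close>. Both walks have to cross both sides of a minimal
  separator inside the strip. The geodesic can do so only near \<open>z\<close>, the other walk only far from \<open>z\<close>, so
  both sides have a large diameter. This is excluded, which gives the bottleneck property for
  walks and vertices (\<open>vertex_bottleneck\<close>). It passes to continuous paths in the realization by a
  connectedness argument (\<open>path_stays_in_component\<close>).

  The tree is built by hand. Fix a base point and identify two vertices of the same level \<open>n\<close>, that is,
  at the same distance \<open>n\<close> from the base point, if they can be joined without going below level \<open>n\<close>.
  In the quotient graph every edge changes the level by one, and every vertex has at most one
  neighbour of lower level (\<open>parent_unique\<close>), so there is no cycle. The quotient map does not increase
  distances. By the bottleneck property the classes have bounded diameter (\<open>end_bounded\<close>), so the map
  shrinks distances by at most a bounded factor, up to a constant, and is a quasi-isometry.\<close>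

section \<open>The combinatorial distance\<close>

locale conn_graph =
  fixes V :: "'a set" and E :: "'a set set"
  assumes conn: "connected_graph V E"
begin

definition adj :: "'a rel" where
  "adj = {(u, v). {u, v} \<in> E}"

definition hop :: "'a \<Rightarrow> 'a \<Rightarrow> nat" where
  "hop u v = (LEAST n. (u, v) \<in> adj ^^ n)"

lemma simple: "simple_graph V E"
  using conn by (simp add: connected_graph_def)

lemma edge_in: "{u, v} \<in> E \<Longrightarrow> u \<in> V \<and> v \<in> V \<and> u \<noteq> v"
  using simple unfolding simple_graph_def by (fastforce simp: doubleton_eq_iff)

lemma adj_sym: "(u, v) \<in> adj \<Longrightarrow> (v, u) \<in> adj"
  by (auto simp: adj_def insert_commute)

lemma component_self: "u \<in> component V E S u"
  by (simp add: component_def)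

lemma component_trans:
  "v \<in> component V E S u \<Longrightarrow> w \<in> component V E S v \<Longrightarrow> w \<in> component V E S u"
  by (auto simp: component_def)

lemma component_edge:
  "v \<in> component V E S u \<Longrightarrow> {v, w} \<in> E \<Longrightarrow> v \<notin> S \<Longrightarrow> w \<notin> S \<Longrightarrow> w \<in> component V E S u"
  using edge_in unfolding component_def by (auto intro: rtrancl_into_rtrancl)

lemma component_sym:
  assumes "v \<in> component V E S u" shows "u \<in> component V E S v"
proof -
  have "sym {(x, y). x \<in> V - S \<and> y \<in> V - S \<and> {x, y} \<in> E}"
    by (auto simp: sym_def insert_commute)
  then show ?thesis using assms sym_rtrancl unfolding component_def sym_def by blast
qed

lemma component_antimono:
  assumes "S' \<subseteq> S" shows "component V E S u \<subseteq> component V E S' u"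
proof -
  have "{(x, y). x \<in> V - S \<and> y \<in> V - S \<and> {x, y} \<in> E}\<^sup>*
      \<subseteq> {(x, y). x \<in> V - S' \<and> y \<in> V - S' \<and> {x, y} \<in> E}\<^sup>*"
    by (rule rtrancl_mono) (use assms in auto)
  then show ?thesis by (auto simp: component_def)
qed

lemma component_induct [consumes 1, case_names base step]:
  assumes "v \<in> component V E S u" and "P u"
    and "\<And>v w. v \<in> component V E S u \<Longrightarrow> v \<in> V - S \<Longrightarrow> w \<in> V - S \<Longrightarrow> {v, w} \<in> E \<Longrightarrow> P v \<Longrightarrow> P w"
  shows "P v"
  using assms(1) unfolding component_def mem_Collect_eq
proof (induction rule: rtrancl_induct)
  case base
  then show ?case by (rule assms(2))
next
  case (step y z)
  then show ?case using assms(3)[of y z] by (auto simp: component_def)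
qed

lemma component_subset: "v \<in> component V E S u \<Longrightarrow> u \<in> V - S \<Longrightarrow> v \<in> V - S"
  by (induction rule: component_induct) auto

lemma adj_path_in: "(u, v) \<in> adj ^^ n \<Longrightarrow> u \<in> V \<Longrightarrow> v \<in> V"
  by (induction n arbitrary: v) (auto simp: adj_def dest: edge_in)

lemma path_exists:
  assumes "u \<in> V" "v \<in> V" shows "\<exists>n. (u, v) \<in> adj ^^ n"
proof -
  have "v \<in> component V E {} u" using conn assms by (simp add: connected_graph_def)
  then show ?thesis
  proof (induction rule: component_induct)
    case base
    show ?case by (rule exI[of _ 0]) simp
  next
    case (step v w)
    then obtain n where "(u, v) \<in> adj ^^ n" by blast
    then have "(u, w) \<in> adj ^^ Suc n" using step by (auto simp: adj_def)
    then show ?case by blast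
  qed
qed

lemma hop_path: "u \<in> V \<Longrightarrow> v \<in> V \<Longrightarrow> (u, v) \<in> adj ^^ hop u v"
  unfolding hop_def by (rule LeastI_ex) (rule path_exists)

lemma hop_le: "(u, v) \<in> adj ^^ n \<Longrightarrow> hop u v \<le> n"
  unfolding hop_def by (rule Least_le)

lemma hop_self [simp]: "hop u u = 0"
  using hop_le[of u u 0] by simp

lemma hop_eq_0: "u \<in> V \<Longrightarrow> v \<in> V \<Longrightarrow> hop u v = 0 \<Longrightarrow> u = v"
  using hop_path[of u v] by simp

lemma hop_triangle:
  "u \<in> V \<Longrightarrow> v \<in> V \<Longrightarrow> w \<in> V \<Longrightarrow> hop u w \<le> hop u v + hop v w"
  by (rule hop_le) (auto simp: relpow_add intro: hop_path)

lemma hop_sym: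
  assumes "u \<in> V" "v \<in> V" shows "hop u v = hop v u"
proof -
  have "(v, u) \<in> adj ^^ n" if "(u, v) \<in> adj ^^ n" for u v n
    using that
  proof (induction n arbitrary: v)
    case (Suc n)
    then obtain w where "(w, u) \<in> adj ^^ n" "(v, w) \<in> adj" by (auto intro: adj_sym)
    then show ?case by (rule relpow_Suc_I2[rotated])
  qed simp
  then show ?thesis using hop_path hop_le assms by (metis le_antisym)
qed

lemma hop_edge: "{u, v} \<in> E \<Longrightarrow> hop u v \<le> 1"
  using hop_le[of u v 1] by (simp add: adj_def)

lemma hop_le_1:
  assumes "u \<in> V" "v \<in> V" "hop u v \<le> 1" shows "u = v \<or> {u, v} \<in> E"
  using hop_path[OF assms(1,2)] assms(3) by (cases "hop u v") (auto simp: adj_def)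

lemma hop_edge_diff:
  assumes "u \<in> V" "{v, w} \<in> E" shows "hop u w \<le> hop u v + 1"
  using hop_triangle[of u v w] hop_edge[OF assms(2)] edge_in[OF assms(2)] assms(1) by simp

lemma between_exists:
  assumes "u \<in> V" "v \<in> V" "k \<le> hop u v"
  obtains w where "w \<in> V" "hop u w = k" "hop w v = hop u v - k"
proof -
  have "(u, v) \<in> adj ^^ k O adj ^^ (hop u v - k)"
    using hop_path[OF assms(1,2)] assms(3) by (simp flip: relpow_add)
  then obtain w where w: "(u, w) \<in> adj ^^ k" "(w, v) \<in> adj ^^ (hop u v - k)" by auto
  have "w \<in> V" using adj_path_in[OF w(1) assms(1)] .
  moreover have "hop u w \<le> k" "hop w v \<le> hop u v - k" using w by (auto intro: hop_le)
  moreover have "hop u v \<le> hop u w + hop w v" using hop_triangle assms \<open>w \<in> V\<close> by blast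
  ultimately show thesis using that[of w] assms(3) by linarith
qed

text \<open>A geodesic from \<open>u\<close> to \<open>v\<close> runs through points \<open>p\<close> with equality in the triangle inequality,
  so it survives the deletion of a set that contains no such \<open>p\<close>.\<close>

lemma geodesic_in_component:
  assumes "u \<in> V" "v \<in> V" "\<And>p. p \<in> V \<Longrightarrow> hop u p + hop p v = hop u v \<Longrightarrow> p \<notin> S"
  shows "v \<in> component V E S u"
  using assms
proof (induction "hop u v" arbitrary: u)
  case 0
  then show ?case using hop_eq_0[of u v] component_self by auto
next
  case (Suc n)
  obtain w where w: "w \<in> V" "hop u w = 1" "hop w v = n"
    using between_exists[of u v 1] Suc.hyps(2) Suc.prems(1,2) by (metis One_nat_def diff_Suc_1 le_add1 plus_1_eq_Suc)
  have uw: "{u, w} \<in> E" using hop_le_1[of u w] w Suc.prems(1) by fastforce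
  have sub: "p \<notin> S" if p: "p \<in> V" "hop w p + hop p v = hop w v" for p
  proof (rule Suc.prems(3)[OF p(1)])
    show "hop u p + hop p v = hop u v"
      using hop_triangle[of u w p] hop_triangle[of u p v] p w Suc.prems(1,2) Suc.hyps(2) by auto
  qed
  have "v \<in> component V E S w" using Suc.hyps(1)[of w] w Suc.prems(2) sub by auto
  moreover have "u \<notin> S" by (rule Suc.prems(3)) (use Suc.prems in auto)
  moreover have "w \<notin> S" by (rule Suc.prems(3)) (use w Suc.hyps(2) in auto)
  ultimately show ?case
    using component_trans component_edge[OF component_self uw] by blast
qed

lemma finite_hop_ball:
  assumes "uniform_graph V E" "u \<in> V"
  shows "finite {v \<in> V. hop u v \<le> n}"
proof (induction n)
  case 0
  have "{v \<in> V. hop u v \<le> 0} \<subseteq> {u}" using hop_eq_0 assms(2) by auto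
  then show ?case by (rule finite_subset) simp
next
  case (Suc n)
  have "{v \<in> V. hop u v \<le> Suc n} \<subseteq>
      {v \<in> V. hop u v \<le> n} \<union> (\<Union>w\<in>{v \<in> V. hop u v \<le> n}. neighbours E w)"
  proof
    fix v assume v: "v \<in> {v \<in> V. hop u v \<le> Suc n}"
    show "v \<in> {v \<in> V. hop u v \<le> n} \<union> (\<Union>w\<in>{v \<in> V. hop u v \<le> n}. neighbours E w)"
    proof (cases "hop u v \<le> n")
      case False
      then obtain w where w: "w \<in> V" "hop u w = n" "hop w v = 1"
        using v assms(2) between_exists[of u v n] by (auto simp: le_Suc_eq)
      then have "{w, v} \<in> E" using hop_le_1[of w v] v by auto
      then show ?thesis using w by (auto simp: neighbours_def)
    qed (use v in auto)
  qed
  then show ?case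
    by (rule finite_subset) (use Suc assms(1) in \<open>auto simp: uniform_graph_def\<close>)
qed


section \<open>The metric of the realization\<close>

text \<open>The hop distance to \<open>u\<close>, extended affinely over the edges. It is 1-Lipschitz along every
  piecewise linear path, which bounds the length of a path from \<open>u\<close> from below.\<close>

definition potential :: "'a \<Rightarrow> ('a \<Rightarrow> real) \<Rightarrow> real" where
  "potential u p = (\<Sum>x\<in>{x. p x \<noteq> 0}. p x * real (hop u x))"

lemma potential_cell:
  assumes "finite e" "p \<in> cell_points e"
  shows "potential u p = (\<Sum>x\<in>e. p x * real (hop u x))"
  unfolding potential_def
  by (rule sum.mono_neutral_left) (use assms in \<open>auto simp: cell_points_def\<close>)

lemma cell_cases:
  assumes "e \<in> cells V E"
  obtains v where "v \<in> V" "e = {v}" | a b where "{a, b} \<in> E" "a \<noteq> b" "e = {a, b}"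
proof (cases "e \<in> E")
  case True
  then obtain a b where "e = {a, b}" "a \<noteq> b" using simple by (auto simp: simple_graph_def)
  then show thesis using that(2)[of a b] True by simp
next
  case False
  then show thesis using assms that(1) by (auto simp: cells_def)
qed

lemma potential_step:
  assumes "u \<in> V" "e \<in> cells V E" "p \<in> cell_points e" "q \<in> cell_points e"
  shows "\<bar>potential u p - potential u q\<bar> \<le> (\<Sum>x\<in>e. \<bar>p x - q x\<bar>) / 2"
  using assms(2)
proof (cases rule: cell_cases)
  case (1 v)
  then have "p v = 1" "q v = 1" using assms(3,4) by (auto simp: cell_points_def)
  then show ?thesis using 1 potential_cell[OF _ assms(3), of u] potential_cell[OF _ assms(4), of u] by simp
next
  case (2 a b)
  have pb: "p b = 1 - p a" and qb: "q b = 1 - q a"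
    using assms(3,4) 2 by (auto simp: cell_points_def)
  have "potential u p - potential u q = (p a - q a) * (real (hop u a) - real (hop u b))"
    using 2 potential_cell[OF _ assms(3), of u] potential_cell[OF _ assms(4), of u]
    by (simp add: pb qb algebra_simps)
  also have "\<bar>\<dots>\<bar> \<le> \<bar>p a - q a\<bar> * 1"
    unfolding abs_mult
  proof (rule mult_left_mono)
    have "{b, a} \<in> E" using 2 by (simp add: insert_commute)
    then show "\<bar>real (hop u a) - real (hop u b)\<bar> \<le> 1"
      using hop_edge_diff[OF assms(1), of a b] hop_edge_diff[OF assms(1), of b a] 2 by simp
  qed simp
  also have "\<dots> = (\<Sum>x\<in>e. \<bar>p x - q x\<bar>) / 2"
    using 2 by (simp add: pb qb)
  finally show ?thesis .
qed

lemma potential_path: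
  assumes "pl_path V E p q l" "u \<in> V"
  shows "\<bar>potential u p - potential u q\<bar> \<le> l"
  using assms
proof (induction rule: pl_path.induct)
  case (step p q l e q')
  then show ?case using potential_step[of u e q q'] by linarith
qed simp

lemma potential_vertex [simp]: "potential u (vertex_point v) = real (hop u v)"
  using potential_cell[OF _ vertex_point_cell[of "{v}" v], of u] by (simp add: vertex_point_def)

lemma path_length:
  assumes "(u, v) \<in> adj ^^ n" "u \<in> V"
  shows "pl_path V E (vertex_point u) (vertex_point v) (real n)"
  using assms
proof (induction n arbitrary: v)
  case 0
  then show ?case using pl_path.refl[OF vertex_point_in] by simp
next
  case (Suc n)
  then obtain w where w: "pl_path V E (vertex_point u) (vertex_point w) (real n)" "{w, v} \<in> E"
    by (auto simp: adj_def)
  have wv: "w \<noteq> v" using edge_in[OF w(2)] by simp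
  have "{w, v} \<in> cells V E" using w by (simp add: cells_def)
  from pl_path.step[OF w(1) this vertex_point_cell vertex_point_cell, of v]
  show ?case using wv by (simp add: vertex_point_def add.commute)
qed

sublocale M: Metric_space "graph_points V E" "graph_dist V E"
  by (rule Metric_space_graph[OF conn])

lemma graph_dist_vertex:
  assumes "u \<in> V" "v \<in> V"
  shows "graph_dist V E (vertex_point u) (vertex_point v) = real (hop u v)"
proof (rule antisym)
  show "graph_dist V E (vertex_point u) (vertex_point v) \<le> real (hop u v)"
    using path_length[OF hop_path] assms by (blast intro: graph_dist_le)
  show "real (hop u v) \<le> graph_dist V E (vertex_point u) (vertex_point v)"
  proof (rule field_le_epsilon)
    fix \<epsilon> :: real assume "0 < \<epsilon>"
    then obtain l where l: "pl_path V E (vertex_point u) (vertex_point v) l"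
      "l < graph_dist V E (vertex_point u) (vertex_point v) + \<epsilon>"
      using graph_dist_approx[OF conn vertex_point_in[OF assms(1)] vertex_point_in[OF assms(2)]]
      by blast
    then show "real (hop u v) \<le> graph_dist V E (vertex_point u) (vertex_point v) + \<epsilon>"
      using potential_path[OF l(1) assms(1)] by simp
  qed
qed

lemma vertex_near_point:
  assumes p: "p \<in> graph_points V E"
  shows "\<exists>v\<in>V. graph_dist V E p (vertex_point v) \<le> 1 / 2"
proof -
  obtain e where e: "e \<in> cells V E" "p \<in> cell_points e" using p by (auto simp: graph_points_def)
  have fin: "finite e" using finite_cell[OF simple e(1)] .
  have le: "graph_dist V E p (vertex_point v) \<le> (\<Sum>x\<in>e. \<bar>p x - vertex_point v x\<bar>) / 2" if "v \<in> e" for v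
    using graph_dist_le[OF pl_path.step[OF pl_path.refl[OF p] e vertex_point_cell[OF fin that]]]
    by simp
  show ?thesis using e(1)
  proof (cases rule: cell_cases)
    case (1 v)
    then have "p v = 1" using e(2) by (simp add: cell_points_def)
    then show ?thesis using 1 le[of v] by (intro bexI[of _ v]) (auto simp: vertex_point_def)
  next
    case (2 a b)
    have pb: "p b = 1 - p a" "0 \<le> p a" "0 \<le> p b" using e(2) 2 by (auto simp: cell_points_def)
    have V: "a \<in> V" "b \<in> V" using edge_in[OF 2(1)] by auto
    show ?thesis
    proof (cases "p a \<le> 1 / 2")
      case True
      then show ?thesis using le[of b] 2 pb V by (intro bexI[of _ b]) (auto simp: vertex_point_def)
    next
      case False
      then show ?thesis using le[of a] 2 pb V by (intro bexI[of _ a]) (auto simp: vertex_point_def)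
    qed
  qed
qed

definition near :: "('a \<Rightarrow> real) \<Rightarrow> 'a" where
  "near p = (SOME v. v \<in> V \<and> graph_dist V E p (vertex_point v) \<le> 1 / 2)"

lemma near:
  assumes "p \<in> graph_points V E"
  shows "near p \<in> V" "graph_dist V E p (vertex_point (near p)) \<le> 1 / 2"
proof -
  have "near p \<in> V \<and> graph_dist V E p (vertex_point (near p)) \<le> 1 / 2"
    unfolding near_def by (rule someI_ex) (use vertex_near_point[OF assms] in blast)
  then show "near p \<in> V" "graph_dist V E p (vertex_point (near p)) \<le> 1 / 2" by auto
qed

lemma hop_near:
  assumes p: "p \<in> graph_points V E" and q: "q \<in> graph_points V E"
  shows "\<bar>real (hop (near p) (near q)) - graph_dist V E p q\<bar> \<le> 1"
proof -
  note in_V = vertex_point_in[OF near(1)[OF p]] vertex_point_in[OF near(1)[OF q]]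
  have "graph_dist V E p q \<le> graph_dist V E p (vertex_point (near p))
      + graph_dist V E (vertex_point (near p)) (vertex_point (near q))
      + graph_dist V E (vertex_point (near q)) q"
    using M.triangle[OF p in_V(1) q] M.triangle[OF in_V q] by linarith
  moreover have "graph_dist V E (vertex_point (near p)) (vertex_point (near q))
      \<le> graph_dist V E (vertex_point (near p)) p + graph_dist V E p q
      + graph_dist V E q (vertex_point (near q))"
    using M.triangle[OF in_V(1) p in_V(2)] M.triangle[OF p q in_V(2)] by linarith
  ultimately show ?thesis
    using near(2)[OF p] near(2)[OF q] graph_dist_vertex[OF near(1)[OF p] near(1)[OF q]]
      M.commute[of p "vertex_point (near p)"] M.commute[of q "vertex_point (near q)"]
    by linarith
qed


section \<open>Thin separators give a bottleneck for vertices\<close>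

text \<open>The first vertex outside the component of \<open>a\<close> on a walk from \<open>a\<close> to \<open>b\<close> lies in the side of
  \<open>a\<close>; it is among the vertices that the walk may use.\<close>

lemma crossing_separator_side:
  assumes "b \<in> component V E S a" and "a \<in> V - T" and "b \<notin> component V E T a"
  obtains s where "s \<in> separator_side V E T a" "s \<in> component V E S a"
proof -
  have "b \<in> component V E T a \<or> (\<exists>s. s \<in> separator_side V E T a \<and> s \<in> component V E S a)"
    using assms(1)
  proof (induction rule: component_induct)
    case base
    then show ?case using component_self by simp
  next
    case (step v w)
    show ?case
    proof (cases "v \<in> component V E T a \<and> w \<in> T")
      case True
      then have "w \<in> separator_side V E T a"
        using step by (auto simp: separator_side_def insert_commute)
      moreover have "w \<in> component V E S a" using step by (auto intro: component_edge)
      ultimately show ?thesis by blast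
    next
      case False
      then show ?thesis using step component_edge[of v T a w] component_subset[of v T a] assms(2) by blast
    qed
  qed
  then show thesis using assms(3) that by blast
qed

text \<open>An edge changes the distance from \<open>x\<close> by at most one, so no edge jumps over the strip.\<close>

lemma component_beyond_strip:
  assumes x: "x \<in> V" and "v \<in> component V E {p \<in> V. k \<le> hop x p \<and> hop x p < k + r} y"
    and "0 < r"
  shows "hop x y < k \<Longrightarrow> hop x v < k" "k + r \<le> hop x y \<Longrightarrow> k + r \<le> hop x v"
  using assms(2)
proof (induction rule: component_induct)
  case (step v w)
  {
    case 1
    then show ?case using step hop_edge_diff[OF x, of v w] \<open>0 < r\<close> by auto
  next
    case 2
    then have "{w, v} \<in> E" using step by (simp add: insert_commute)
    then show ?case using 2 step hop_edge_diff[OF x, of w v] \<open>0 < r\<close> by auto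
  }
qed auto

lemma strip_r_separator:
  assumes x: "x \<in> V" and y: "y \<in> V" and "0 < r" "0 < k" "k + r \<le> hop x y"
  shows "r_separator V E r x y {p \<in> V. k \<le> hop x p \<and> hop x p < k + r}" (is "r_separator V E r x y ?S")
  unfolding r_separator_def
proof (intro conjI ballI)
  have xS: "x \<in> V - ?S" and yS: "y \<in> V - ?S" using assms by auto
  then show "x \<in> V - ?S" "y \<in> V - ?S" by auto
  fix v w assume vw: "v \<in> component V E ?S x" "w \<in> component V E ?S y"
  have V: "v \<in> V" "w \<in> V" using component_subset[OF vw(1) xS] component_subset[OF vw(2) yS] by auto
  have "hop x v < k" using component_beyond_strip(1)[OF x vw(1)] assms by simp
  moreover have "k + r \<le> hop x w" using component_beyond_strip(2)[OF x vw(2)] assms by simp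
  moreover have "hop x w \<le> hop x v + hop v w" using hop_triangle x V by blast
  ultimately show "real r < vertex_dist V E v w"
    unfolding vertex_dist_def graph_dist_vertex[OF V] by linarith
qed auto

lemma r_separator_imp_separated:
  assumes "r_separator V E r a b T" shows "b \<notin> component V E T a"
  using assms component_self[of b T] graph_dist_vertex[of b b]
  by (fastforce simp: r_separator_def vertex_dist_def)

lemma minimal_r_separator_exists:
  assumes "r_separator V E r a b S" "finite S"
  obtains T where "T \<subseteq> S" "minimal_r_separator V E r a b T"
proof -
  obtain T where T: "T \<subseteq> S \<and> r_separator V E r a b T"
    and least: "\<And>T'. T' \<subseteq> S \<and> r_separator V E r a b T' \<Longrightarrow> card T \<le> card T'"
    using exists_least_iff[of "\<lambda>n. \<exists>T. (T \<subseteq> S \<and> r_separator V E r a b T) \<and> card T = n"] assms(1)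
    by (metis (no_types, lifting) linorder_le_less_linear order_refl)
  have "finite T" using T assms(2) finite_subset by blast
  then have "minimal_r_separator V E r a b T"
    using T least psubset_card_mono[of T] unfolding minimal_r_separator_def
    by (meson leD order_trans psubset_imp_subset)
  then show thesis using that T by blast
qed

lemma vertex_diam_ge:
  assumes "A \<subseteq> V" "s \<in> A" "t \<in> A" "vertex_diam V E A \<le> of_nat m"
  shows "hop s t \<le> m"
proof -
  have "ennreal (vertex_dist V E s t) \<le> vertex_diam V E A"
    unfolding vertex_diam_def using assms(2,3) by (meson SUP_upper2 order_refl)
  then have "ennreal (real (hop s t)) \<le> of_nat m"
    using assms(4) graph_dist_vertex[of s t] assms(1-3) order_trans
    by (fastforce simp: vertex_dist_def)
  then show ?thesis by (simp flip: ennreal_of_nat_eq_real_of_nat)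
qed

text \<open>A component of \<open>G \<setminus> S\<close> stands for the set of vertices that a walk from \<open>x\<close> to \<open>y\<close> may use; a
  suitable \<open>S\<close> confines the walk to two geodesics, to the complement of a ball,
  or to the levels from \<open>n\<close> on. If such a walk stayed far from \<open>z\<close>, let \<open>k = d(x, z)\<close>. The strip of
  vertices at distance \<open>k, \<dots>, k + r - 1\<close> from \<open>x\<close> is finite by uniformity, so it contains a minimal
  separator \<open>T\<close>. Each side of \<open>T\<close> meets the walk through \<open>z\<close> made of two geodesics,
  necessarily near \<open>z\<close> because \<open>T\<close> lies in the strip. Each side also meets the walk that stays far
  from \<open>z\<close>, so it has diameter larger than \<open>m\<close>.

  The slack \<open>3\<close> pays for moving three points of the realization to nearby vertices.\<close>

lemma vertex_bottleneck:
  assumes unif: "uniform_graph V E" and r: "0 < r"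
    and thin: "\<And>a b S. a \<in> V \<Longrightarrow> b \<in> V \<Longrightarrow> minimal_r_separator V E r a b S \<Longrightarrow>
           vertex_diam V E (separator_side V E S a) \<le> of_nat m \<or>
           vertex_diam V E (separator_side V E S b) \<le> of_nat m"
    and x: "x \<in> V - S" and y: "y \<in> component V E S x" and z: "z \<in> V"
    and xzy: "hop x z + hop z y \<le> hop x y + 3"
  shows "\<exists>v\<in>component V E S x. hop z v \<le> m + r + 3"
proof (rule ccontr)
  assume "\<not> ?thesis"
  then have far: "m + r + 3 < hop z v" if "v \<in> component V E S x" for v
    using that by fastforce
  have xV: "x \<in> V" and yV: "y \<in> V" using x component_subset[OF y x] by auto
  define k where "k = hop x z"
  define strip where "strip = {p \<in> V. k \<le> hop x p \<and> hop x p < k + r}"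
  have k: "0 < k" using far[OF component_self] hop_sym[of x z] xV z by (simp add: k_def)
  have ky: "k + r \<le> hop x y" using far[OF y] xzy by (simp add: k_def)
  have fin: "finite strip"
    by (rule finite_subset[OF _ finite_hop_ball[OF unif xV, of "k + r"]]) (auto simp: strip_def)
  have strip_sep: "r_separator V E r x y strip"
    unfolding strip_def by (rule strip_r_separator[OF xV yV r k ky])
  obtain T where T: "T \<subseteq> strip" "minimal_r_separator V E r x y T"
    by (rule minimal_r_separator_exists[OF strip_sep fin])
  have sep: "r_separator V E r x y T" using T(2) by (simp add: minimal_r_separator_def)
  then have inT: "x \<in> V - T" "y \<in> V - T" by (auto simp: r_separator_def)
  have xy: "y \<notin> component V E T x" by (rule r_separator_imp_separated[OF sep])
  then have yx: "x \<notin> component V E T y" using component_sym by blast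

  \<comment> \<open>Deleting \<open>off\<close> leaves exactly the vertices on geodesics from \<open>x\<close> to \<open>z\<close> and from \<open>z\<close> to \<open>y\<close>.\<close>
  define off where "off = {p \<in> V. hop x p + hop p z \<noteq> hop x z \<and> hop z p + hop p y \<noteq> hop z y}"
  have "z \<in> component V E off x"
    by (rule geodesic_in_component) (use xV z in \<open>auto simp: off_def\<close>)
  moreover have "y \<in> component V E off z"
    by (rule geodesic_in_component) (use yV z in \<open>auto simp: off_def\<close>)
  ultimately have geo: "y \<in> component V E off x" by (rule component_trans)
  have close: "hop z s \<le> r + 3" if s: "s \<in> T" "s \<in> V - off" for s
  proof -
    have sV: "s \<in> V" and strip: "k \<le> hop x s" "hop x s < k + r" using s T(1) by (auto simp: strip_def)
    have "hop x s + hop s z = hop x z \<or> hop z s + hop s y = hop z y" using s by (auto simp: off_def)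
    moreover have "hop x y \<le> hop x s + hop s y" using hop_triangle xV yV sV by blast
    ultimately show ?thesis using strip xzy hop_sym[OF sV z] unfolding k_def by linarith
  qed
  have wide: "\<not> vertex_diam V E (separator_side V E T c) \<le> of_nat m"
    if c: "c \<in> V - T" and offc: "c \<in> V - off" and sep: "e \<notin> component V E T c"
      and offw: "e \<in> component V E off c"
      and Sw: "e \<in> component V E S c" "component V E S c = component V E S x" for c e
  proof
    assume diam: "vertex_diam V E (separator_side V E T c) \<le> of_nat m"
    obtain s where s: "s \<in> separator_side V E T c" "s \<in> component V E off c"
      by (rule crossing_separator_side[OF offw c sep])
    obtain t where t: "t \<in> separator_side V E T c" "t \<in> component V E S c"
      by (rule crossing_separator_side[OF Sw(1) c sep])
    have side: "separator_side V E T c \<subseteq> T" by (auto simp: separator_side_def)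
    moreover have TV: "T \<subseteq> V" using T(1) by (auto simp: strip_def)
    ultimately have "hop s t \<le> m" using vertex_diam_ge[of _ s t m] s t diam by blast
    moreover have "hop z s \<le> r + 3"
      by (rule close) (use s side component_subset[OF s(2) offc] in auto)
    moreover have "m + r + 3 < hop z t" using far t(2) Sw(2) by blast
    moreover have "hop z t \<le> hop z s + hop s t"
      using hop_triangle z s(1) t(1) side TV by blast
    ultimately show False by linarith
  qed
  have "component V E S y = component V E S x"
    using y component_sym component_trans by blast
  moreover have "x \<in> V - off" "y \<in> V - off" using xV yV by (auto simp: off_def)
  ultimately show False
    using wide[OF inT(1) _ xy geo y] wide[OF inT(2) _ yx component_sym[OF geo] component_sym[OF y]]
      thin[OF xV yV T(2)] by blast
qed


section \<open>From vertices to the realization\<close>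

text \<open>A path in the realization that avoids a ball about \<open>z\<close> cannot leave the component of the
  graph, with a slightly smaller ball deleted, in which it starts: the points within \<open>3/4\<close> of this
  component and the points within \<open>3/4\<close> of the other vertices are two open sets that cover
  everything, because all points are within \<open>1/2\<close> of a vertex. A common point would be close to an edge
  that leaves the component, hence close to the ball.\<close>

lemma path_stays_in_component:
  fixes \<Delta> :: nat
  assumes z: "z \<in> graph_points V E" and g: "pathin M.mtopology g"
    and far: "\<And>t. t \<in> {0..1} \<Longrightarrow> real \<Delta> + 2 < graph_dist V E z (g t)"
  defines "S \<equiv> {v \<in> V. hop (near z) v \<le> \<Delta>}"
  shows "near (g 0) \<in> V - S" "near (g 1) \<in> component V E S (near (g 0))"
proof -
  have gM: "g t \<in> graph_points V E" if "t \<in> {0..1}" for t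
    using g that by (auto simp: pathin_def continuous_map_def)
  have g0: "g 0 \<in> graph_points V E" and g1: "g 1 \<in> graph_points V E" using gM by auto
  show start: "near (g 0) \<in> V - S"
    using far[of 0] hop_near[OF z g0] near[OF g0] by (auto simp: S_def)
  define C where "C = component V E S (near (g 0))"
  have CV: "C \<subseteq> V - S" using component_subset start by (auto simp: C_def)
  let ?U = "\<lambda>A. \<Union>v\<in>A. M.mball (vertex_point v) (3 / 4)"
  have in_U: "p \<in> ?U A" if "p \<in> graph_points V E" "near p \<in> A" for p A
  proof -
    have "p \<in> M.mball (vertex_point (near p)) (3 / 4)"
      using near[OF that(1)] that(1) vertex_point_in M.commute[of p] by auto
    then show ?thesis using that(2) by blast
  qed
  have disj: "p \<notin> ?U (V - C)" if p: "p \<in> g ` {0..1}" "p \<in> ?U C" for p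
  proof
    assume "p \<in> ?U (V - C)"
    then obtain w where w: "w \<in> V" "w \<notin> C" "graph_dist V E (vertex_point w) p < 3 / 4"
      and pM: "p \<in> graph_points V E" by auto
    obtain v where v: "v \<in> C" "graph_dist V E (vertex_point v) p < 3 / 4" using p(2) by auto
    have vV: "v \<in> V" using v CV by auto
    note vp = vertex_point_in[OF vV] vertex_point_in[OF w(1)]
    have "real (hop v w) < 3 / 2"
      using M.triangle[OF vp(1) pM vp(2)] v w graph_dist_vertex[OF vV w(1)] M.commute[of p "vertex_point w"]
      by linarith
    then have "{v, w} \<in> E" using hop_le_1[OF vV w(1)] v w by auto
    then have "w \<in> S" using component_edge[of v S "near (g 0)" w] v w(2) CV by (auto simp: C_def)
    then have "hop (near z) w \<le> \<Delta>" by (simp add: S_def)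
    then have "graph_dist V E (vertex_point (near z)) (vertex_point w) \<le> real \<Delta>"
      using graph_dist_vertex[OF near(1)[OF z] w(1)] by simp
    then have "graph_dist V E z p \<le> 1 / 2 + real \<Delta> + 3 / 4"
      using M.triangle[OF z vertex_point_in[OF near(1)[OF z]] pM] near(2)[OF z]
        M.triangle[OF vertex_point_in[OF near(1)[OF z]] vp(2) pM] w(3) by linarith
    then show False using far p(1) by fastforce
  qed
  have "connectedin M.mtopology (g ` {0..1})" by (rule connectedin_path_image[OF g])
  moreover have "openin M.mtopology (?U A)" for A by (auto intro: openin_Union)
  moreover have "g ` {0..1} \<subseteq> ?U C \<union> ?U (V - C)"
  proof
    fix p assume "p \<in> g ` {0..1}"
    then have p: "p \<in> graph_points V E" using gM by auto
    show "p \<in> ?U C \<union> ?U (V - C)"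
      using in_U[OF p, of C] in_U[OF p, of "V - C"] near(1)[OF p] by blast
  qed
  moreover have "?U C \<inter> ?U (V - C) \<inter> g ` {0..1} = {}" using disj by blast
  moreover have "?U C \<inter> g ` {0..1} \<noteq> {}"
    using in_U[OF g0, of C] component_self by (fastforce simp: C_def)
  ultimately have "?U (V - C) \<inter> g ` {0..1} = {}"
    unfolding connectedin by blast
  moreover have "g 1 \<in> g ` {0..1}" by simp
  ultimately have "g 1 \<notin> ?U (V - C)" by blast
  then show "near (g 1) \<in> component V E S (near (g 0))"
    using in_U[OF g1, of "V - C"] near(1)[OF g1] by (auto simp: C_def)
qed

lemma bottleneck_property_realization:
  fixes \<Delta> :: nat
  assumes bottleneck: "\<And>x y z S. x \<in> V - S \<Longrightarrow> y \<in> component V E S x \<Longrightarrow> z \<in> V \<Longrightarrow>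
      hop x z + hop z y \<le> hop x y + 3 \<Longrightarrow> \<exists>v\<in>component V E S x. hop z v \<le> \<Delta>"
  shows "bottleneck_property (graph_points V E) (graph_dist V E)"
  unfolding bottleneck_property_def
proof (intro exI[of _ "real \<Delta> + 2"] conjI ballI impI allI)
  fix x y z g
  assume x: "x \<in> graph_points V E" and y: "y \<in> graph_points V E" and z: "z \<in> graph_points V E"
    and mid: "x \<noteq> y \<and> graph_dist V E x z = graph_dist V E x y / 2 \<and>
      graph_dist V E z y = graph_dist V E x y / 2"
    and g: "pathin M.mtopology g \<and> g 0 = x \<and> g 1 = y"
  show "\<exists>t\<in>{0..1}. graph_dist V E z (g t) \<le> real \<Delta> + 2"
  proof (rule ccontr)
    assume "\<not> ?thesis"
    then have far: "real \<Delta> + 2 < graph_dist V E z (g t)" if "t \<in> {0..1}" for t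
      using that not_less by blast
    define S where "S = {v \<in> V. hop (near z) v \<le> \<Delta>}"
    have start: "near x \<in> V - S" and comp: "near y \<in> component V E S (near x)"
      using path_stays_in_component[of z g \<Delta>, OF z _ far] g unfolding S_def by blast+
    have "hop (near x) (near z) + hop (near z) (near y) \<le> hop (near x) (near y) + 3"
      using hop_near[OF x z] hop_near[OF z y] hop_near[OF x y] mid by linarith
    then obtain v where v: "v \<in> component V E S (near x)" "hop (near z) v \<le> \<Delta>"
      using bottleneck[OF start comp near(1)[OF z]] by blast
    then show False using component_subset[OF v(1) start] by (simp add: S_def)
  qed
qed simp

end


section \<open>The tree of ends of the levels\<close>

locale rooted_graph = conn_graph +
  fixes base :: 'a
  assumes base: "base \<in> V"
begin

abbreviation level :: "'a \<Rightarrow> nat" where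
  "level \<equiv> hop base"

text \<open>The classes are the components of the subgraph of level at least \<open>n\<close>, each represented by its
  lowest vertices, those of level \<open>n\<close>. For growing \<open>n\<close> these components are nested, which makes them
  a tree.\<close>

definition same_end :: "'a \<Rightarrow> 'a \<Rightarrow> bool" where
  "same_end u v \<longleftrightarrow> u \<in> V \<and> v \<in> V \<and> level u = level v \<and>
     v \<in> component V E {w. level w < level u} u"

text \<open>Representatives keep the vertices of the tree in the vertex type of the graph.\<close>

definition rep :: "'a \<Rightarrow> 'a" where
  "rep u = (SOME v. same_end u v)"

definition tree_vertices :: "'a set" where
  "tree_vertices = rep ` V"

definition tree_edges :: "'a set set" where
  "tree_edges = {{rep u, rep v} | u v. {u, v} \<in> E \<and> rep u \<noteq> rep v}"

lemma same_end_refl: "u \<in> V \<Longrightarrow> same_end u u"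
  by (simp add: same_end_def component_self)

lemma same_end_sym: "same_end u v \<Longrightarrow> same_end v u"
  using component_sym by (fastforce simp: same_end_def)

lemma same_end_trans: "same_end u v \<Longrightarrow> same_end v w \<Longrightarrow> same_end u w"
  using component_trans unfolding same_end_def by metis

lemma same_end_rep: "u \<in> V \<Longrightarrow> same_end u (rep u)"
  unfolding rep_def by (rule someI[of "same_end u"]) (rule same_end_refl)

lemma level_rep: "u \<in> V \<Longrightarrow> level (rep u) = level u"
  using same_end_rep by (auto simp: same_end_def)

lemma rep_eq_iff: "u \<in> V \<Longrightarrow> v \<in> V \<Longrightarrow> rep u = rep v \<longleftrightarrow> same_end u v"
proof
  assume "u \<in> V" "v \<in> V" "rep u = rep v"
  then show "same_end u v" using same_end_rep same_end_sym same_end_trans by metis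
next
  assume "same_end u v"
  then have "same_end u = same_end v" using same_end_sym same_end_trans by blast
  then show "rep u = rep v" by (simp add: rep_def)
qed

lemma tree_edge_cases:
  assumes "{s, t} \<in> tree_edges"
  obtains u v where "{u, v} \<in> E" "s = rep u" "t = rep v" "u \<in> V" "v \<in> V" "rep u \<noteq> rep v"
proof -
  obtain u v where uv: "{u, v} \<in> E" "{s, t} = {rep u, rep v}" "rep u \<noteq> rep v"
    using assms by (auto simp: tree_edges_def)
  then consider "s = rep u" "t = rep v" | "s = rep v" "t = rep u" by (auto simp: doubleton_eq_iff)
  then show thesis
  proof cases
    case 1
    then show thesis using that[of u v] uv edge_in[OF uv(1)] by blast
  next
    case 2
    then show thesis using that[of v u] uv edge_in[OF uv(1)] by (auto simp: insert_commute)
  qed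
qed

lemma tree_edge_levels:
  assumes "{s, t} \<in> tree_edges"
  shows "level s = level t + 1 \<or> level t = level s + 1"
proof -
  obtain u v where uv: "{u, v} \<in> E" "s = rep u" "t = rep v" "u \<in> V" "v \<in> V" "rep u \<noteq> rep v"
    using tree_edge_cases[OF assms] .
  have vu: "{v, u} \<in> E" using uv by (simp add: insert_commute)
  have "level u \<noteq> level v"
  proof
    assume "level u = level v"
    then have "same_end u v"
      using uv component_edge[OF component_self uv(1)] by (auto simp: same_end_def)
    then show False using uv rep_eq_iff by blast
  qed
  then show ?thesis
    using hop_edge_diff[OF base uv(1)] hop_edge_diff[OF base vu] uv level_rep by auto
qed

text \<open>If \<open>s\<close> and \<open>t\<close> are both below \<open>c\<close>, a walk between vertices of the end \<open>c\<close> extends by one edge at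
  either side to a walk that joins \<open>s\<close> to \<open>t\<close> without going below their common level.\<close>

lemma parent_unique:
  assumes sc: "{s, c} \<in> tree_edges" "level s < level c"
    and tc: "{t, c} \<in> tree_edges" "level t < level c"
  shows "s = t"
proof -
  obtain u v where uv: "{u, v} \<in> E" "s = rep u" "c = rep v" "u \<in> V" "v \<in> V"
    using tree_edge_cases[OF sc(1)] by metis
  obtain u' v' where uv': "{u', v'} \<in> E" "t = rep u'" "c = rep v'" "u' \<in> V" "v' \<in> V"
    using tree_edge_cases[OF tc(1)] by metis
  have "level s = level u" "level c = level v" "level t = level u'" "level c = level v'"
    using uv uv' level_rep by metis+
  then have lv: "level v = level u + 1" "level v' = level u' + 1"
    using tree_edge_levels[OF sc(1)] tree_edge_levels[OF tc(1)] sc(2) tc(2) by linarith+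
  have "same_end v v'" using rep_eq_iff uv uv' by blast
  then have vv': "level v = level v'" "v' \<in> component V E {w. level w < level v} v"
    by (auto simp: same_end_def)
  have "{w. level w < level u} \<subseteq> {w. level w < level v}" using lv by auto
  then have 1: "v' \<in> component V E {w. level w < level u} v"
    using vv'(2) component_antimono by blast
  have 2: "v \<in> component V E {w. level w < level u} u"
    using component_edge[OF component_self uv(1)] lv by simp
  have "{v', u'} \<in> E" using uv' by (simp add: insert_commute)
  then have "u' \<in> component V E {w. level w < level u} u"
    using component_edge[OF component_trans[OF 2 1], of u'] lv vv' by auto
  then have "same_end u u'" using uv uv' lv vv' by (simp add: same_end_def)
  then show ?thesis using rep_eq_iff uv uv' by simp
qed

lemma tree_simple: "simple_graph tree_vertices tree_edges"
  using edge_in by (fastforce simp: simple_graph_def tree_vertices_def tree_edges_def)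

lemma tree_path:
  assumes "v \<in> component V E {} u"
  shows "rep v \<in> component tree_vertices tree_edges {} (rep u)"
  using assms
proof (induction rule: component_induct)
  case base
  then show ?case by (simp add: component_def)
next
  case (step v w)
  show ?case
  proof (cases "rep v = rep w")
    case True
    then show ?thesis using step by simp
  next
    case False
    then have "{rep v, rep w} \<in> tree_edges" using step by (auto simp: tree_edges_def)
    then show ?thesis using step
      by (auto simp: component_def tree_vertices_def intro: rtrancl_into_rtrancl)
  qed
qed

lemma tree_connected: "connected_graph tree_vertices tree_edges"
  using tree_simple tree_path conn base
  by (auto simp: connected_graph_def tree_vertices_def)

end

lemma cycle_two_neighbours:
  assumes "is_cycle F vs" "c \<in> set vs"
  obtains a b where "a \<in> set vs" "b \<in> set vs" "a \<noteq> b" "{a, c} \<in> F" "{b, c} \<in> F"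
proof -
  define n where "n = length vs"
  have n: "3 \<le> n" "distinct vs" using assms(1) by (auto simp: is_cycle_def n_def)
  have edge: "{vs ! j, vs ! Suc j} \<in> F" if "Suc j < n" for j
    using assms(1) that by (auto simp: is_cycle_def n_def successively_conv_nth)
  have closing: "{vs ! (n - 1), vs ! 0} \<in> F"
  proof -
    have "vs \<noteq> []" using n(1) by (auto simp: n_def)
    then show ?thesis using assms(1) by (simp add: is_cycle_def n_def last_conv_nth hd_conv_nth)
  qed
  have in_vs: "vs ! j \<in> set vs" if "j < n" for j using that by (simp add: n_def)
  have neq: "vs ! j \<noteq> vs ! k" if "j < n" "k < n" "j \<noteq> k" for j k
    using that n(2) by (simp add: n_def nth_eq_iff_index_eq)
  obtain i where i: "i < n" "c = vs ! i" using assms(2) by (auto simp: in_set_conv_nth n_def)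
  consider "i = 0" | "i = n - 1" | "0 < i" "Suc i < n" using i by linarith
  then show thesis
  proof cases
    case 1
    then show thesis
      using that[of "vs ! 1" "vs ! (n - 1)"] edge[of 0] closing in_vs neq n i
      by (auto simp: insert_commute)
  next
    case 2
    have "Suc (n - 2) = n - 1" using n by simp
    then show thesis
      using that[of "vs ! 0" "vs ! (n - 2)"] edge[of "n - 2"] closing in_vs neq n i 2
      by (auto simp: insert_commute)
  next
    case 3
    have "Suc (i - 1) = i" using 3 by simp
    then show thesis
      using that[of "vs ! Suc i" "vs ! (i - 1)"] edge[of "i - 1"] edge[of i] in_vs neq n i 3
      by (auto simp: insert_commute)
  qed
qed

context rooted_graph
begin

text \<open>On a cycle, a vertex of the highest level would have two parents.\<close>

lemma tree: "tree_graph tree_vertices tree_edges"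
  unfolding tree_graph_def
proof (intro conjI notI tree_connected)
  assume "\<exists>vs. is_cycle tree_edges vs"
  then obtain vs where vs: "is_cycle tree_edges vs" ..
  then have "vs \<noteq> []" by (auto simp: is_cycle_def)
  then have "Max (level ` set vs) \<in> level ` set vs" by (intro Max_in) auto
  then obtain c where c: "c \<in> set vs" "level c = Max (level ` set vs)" by auto
  have top: "level v \<le> level c" if "v \<in> set vs" for v using that c(2) by simp
  obtain a b where ab: "a \<in> set vs" "b \<in> set vs" "a \<noteq> b" "{a, c} \<in> tree_edges" "{b, c} \<in> tree_edges"
    using cycle_two_neighbours[OF vs c(1)] .
  then have "level a < level c" "level b < level c"
    using tree_edge_levels[OF ab(4)] tree_edge_levels[OF ab(5)] top[OF ab(1)] top[OF ab(2)] by auto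
  then show False using parent_unique ab by blast
qed

sublocale T: conn_graph tree_vertices tree_edges
  by unfold_locales (rule tree_connected)

lemma tree_hop_le:
  assumes "u \<in> V" "v \<in> V" shows "T.hop (rep u) (rep v) \<le> hop u v"
proof -
  have "T.hop (rep u) (rep v) \<le> n" if "(u, v) \<in> adj ^^ n" for n
    using that
  proof (induction n arbitrary: v)
    case (Suc n)
    then obtain w where w: "(u, w) \<in> adj ^^ n" "{w, v} \<in> E" by (auto simp: adj_def)
    have wv: "w \<in> V" "v \<in> V" using edge_in[OF w(2)] by auto
    have "T.hop (rep w) (rep v) \<le> 1"
    proof (cases "rep w = rep v")
      case False
      then show ?thesis using w(2) by (intro T.hop_edge) (auto simp: tree_edges_def)
    qed simp
    moreover have "T.hop (rep u) (rep v) \<le> T.hop (rep u) (rep w) + T.hop (rep w) (rep v)"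
      using assms(1) wv by (intro T.hop_triangle) (auto simp: tree_vertices_def)
    ultimately show ?case using Suc.IH[OF w(1)] by linarith
  qed simp
  then show ?thesis using hop_path[OF assms] by blast
qed

text \<open>Each edge of the tree comes from an edge of the graph, so a path in the tree lifts to the graph
  at the cost of one jump inside an end per vertex.\<close>

lemma hop_le_tree_hop:
  assumes K: "\<And>u v. same_end u v \<Longrightarrow> hop u v \<le> K" and "u \<in> V" "v \<in> V"
  shows "hop u v \<le> (K + 1) * T.hop (rep u) (rep v) + K"
proof -
  have "hop u v \<le> (K + 1) * n + K" if "(rep u, rep v) \<in> T.adj ^^ n" "v \<in> V" for n
    using that
  proof (induction n arbitrary: v)
    case 0
    then show ?case using K[of u v] rep_eq_iff assms(2) by simp
  next
    case (Suc n)
    then obtain t where t: "(rep u, t) \<in> T.adj ^^ n" "{t, rep v} \<in> tree_edges"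
      by (auto simp: T.adj_def)
    obtain p q where pq: "{p, q} \<in> E" "t = rep p" "rep v = rep q" "p \<in> V" "q \<in> V"
      using tree_edge_cases[OF t(2)] by metis
    have "hop u p \<le> (K + 1) * n + K" using Suc.IH t(1) pq by simp
    moreover have "hop p q \<le> 1" by (rule hop_edge[OF pq(1)])
    moreover have "hop q v \<le> K" using K rep_eq_iff[of q v] pq Suc.prems(2) by simp
    moreover have "hop u v \<le> hop u p + hop p v" "hop p v \<le> hop p q + hop q v"
      using hop_triangle assms(2) pq Suc.prems(2) by blast+
    ultimately show ?case by (simp add: algebra_simps)
  qed
  then show ?thesis
    using T.hop_path[of "rep u" "rep v"] assms(2,3) by (auto simp: tree_vertices_def)
qed

text \<open>Let \<open>z\<close> be a midpoint of two vertices \<open>u\<close>, \<open>v\<close> of an end at level \<open>n\<close>. A walk that stays at level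
  at least \<open>n\<close> passes near \<open>z\<close>, so \<open>z\<close> has level at least \<open>n - \<Delta>\<close>. The walk along geodesics
  through the base point also passes near \<open>z\<close>, at a point of level at least \<open>n - 2\<Delta>\<close>; on these
  geodesics that point is within \<open>2\<Delta>\<close> of \<open>u\<close> or \<open>v\<close>.\<close>

lemma end_bounded:
  assumes bottleneck: "\<And>x y z S. x \<in> V - S \<Longrightarrow> y \<in> component V E S x \<Longrightarrow> z \<in> V \<Longrightarrow>
      hop x z + hop z y \<le> hop x y + 3 \<Longrightarrow> \<exists>v\<in>component V E S x. hop z v \<le> \<Delta>"
    and uv: "same_end u v"
  shows "hop u v \<le> 6 * \<Delta> + 1"
proof -
  have V: "u \<in> V" "v \<in> V" and lev: "level u = level v"
    and comp: "v \<in> component V E {w. level w < level u} u"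
    using uv by (auto simp: same_end_def)
  obtain z where z: "z \<in> V" "hop u z = hop u v div 2" "hop z v = hop u v - hop u v div 2"
    using between_exists[OF V, of "hop u v div 2"] by auto
  then have mid: "hop u z + hop z v \<le> hop u v + 3" by simp
  obtain p where p: "p \<in> component V E {w. level w < level u} u" "hop z p \<le> \<Delta>"
    using bottleneck[OF _ comp z(1) mid] V by auto
  have p': "p \<in> V" "level u \<le> level p" using component_subset[OF p(1)] V by auto
  have zlev: "level u \<le> level z + \<Delta>"
    using hop_triangle[OF base z(1) p'(1)] p p' by linarith
  \<comment> \<open>Deleting \<open>off\<close> leaves the vertices on geodesics from the base point to \<open>u\<close> or \<open>v\<close>.\<close>
  define off where
    "off = {q \<in> V. hop base q + hop q u \<noteq> level u \<and> hop base q + hop q v \<noteq> level v}"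
  have "u \<in> component V E off base" "v \<in> component V E off base"
    by (rule geodesic_in_component; use base V in \<open>auto simp: off_def\<close>)+
  then have "v \<in> component V E off u" using component_sym component_trans by blast
  moreover have u: "u \<in> V - off" using V by (auto simp: off_def)
  ultimately obtain q where q: "q \<in> component V E off u" "hop z q \<le> \<Delta>"
    using bottleneck[OF _ _ z(1) mid] by blast
  have qV: "q \<in> V" "q \<notin> off" using component_subset[OF q(1) u] by auto
  have "level z \<le> level q + hop q z" using hop_triangle base qV z(1) by blast
  then have qlev: "level u \<le> level q + 2 * \<Delta>" using zlev q(2) hop_sym[OF z(1) qV(1)] by linarith
  have "hop q u \<le> 2 * \<Delta> \<or> hop q v \<le> 2 * \<Delta>"
    using qV qlev lev by (auto simp: off_def)
  then have "hop z u \<le> 3 * \<Delta> \<or> hop z v \<le> 3 * \<Delta>"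
    using hop_triangle[OF z(1) qV(1) V(1)] hop_triangle[OF z(1) qV(1) V(2)] q(2) by linarith
  then show ?thesis using z hop_sym[OF z(1) V(1)] by linarith
qed

lemma quasi_isometry_to_tree:
  assumes K: "\<And>u v. same_end u v \<Longrightarrow> hop u v \<le> K"
  shows "quasi_isometry (graph_points V E) (graph_dist V E)
    (graph_points tree_vertices tree_edges) (graph_dist tree_vertices tree_edges)
    (\<lambda>p. vertex_point (rep (near p)))"
proof -
  let ?f = "\<lambda>p. vertex_point (rep (near p))"
  let ?dT = "graph_dist tree_vertices tree_edges"
  have rep_T: "rep v \<in> tree_vertices" if "v \<in> V" for v using that by (simp add: tree_vertices_def)
  have dT: "?dT (?f p) (?f q) = real (T.hop (rep (near p)) (rep (near q)))"
    if "p \<in> graph_points V E" "q \<in> graph_points V E" for p q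
    using T.graph_dist_vertex rep_T near(1) that by simp
  have lower: "graph_dist V E p q / real (K + 1) - 1 \<le> ?dT (?f p) (?f q)"
    and upper: "?dT (?f p) (?f q) \<le> real (K + 1) * graph_dist V E p q + 1"
    if pq: "p \<in> graph_points V E" "q \<in> graph_points V E" for p q
  proof -
    let ?n = "T.hop (rep (near p)) (rep (near q))"
    have "hop (near p) (near q) \<le> (K + 1) * ?n + K"
      using hop_le_tree_hop[OF K near(1)[OF pq(1)] near(1)[OF pq(2)]] by simp
    then have "real (hop (near p) (near q)) \<le> real (K + 1) * real ?n + real K"
      by (metis of_nat_add of_nat_le_iff of_nat_mult)
    then have "graph_dist V E p q \<le> real (K + 1) * (real ?n + 1)"
      using hop_near[OF pq] by (simp add: algebra_simps)
    then show "graph_dist V E p q / real (K + 1) - 1 \<le> ?dT (?f p) (?f q)"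
      unfolding dT[OF pq] by (simp add: field_simps)
    have "real ?n \<le> real (hop (near p) (near q))"
      using tree_hop_le[OF near(1)[OF pq(1)] near(1)[OF pq(2)]] by simp
    moreover have "1 * graph_dist V E p q \<le> real (K + 1) * graph_dist V E p q"
      by (rule mult_right_mono) simp_all
    ultimately show "?dT (?f p) (?f q) \<le> real (K + 1) * graph_dist V E p q + 1"
      unfolding dT[OF pq] using hop_near[OF pq] by linarith
  qed
  have dense: "(INF x\<in>graph_points V E. ?dT t (?f x)) \<le> 1"
    if t: "t \<in> graph_points tree_vertices tree_edges" for t
  proof -
    obtain v where v: "v \<in> V" "T.near t = rep v" using T.near(1)[OF t] by (auto simp: tree_vertices_def)
    let ?x = "vertex_point v"
    have x: "?x \<in> graph_points V E" using v by (intro vertex_point_in)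
    have "hop v (near ?x) = 0"
      using near[OF x] v(1) graph_dist_vertex[of v "near ?x"] by simp
    then have "near ?x = v" using hop_eq_0[of v "near ?x"] v(1) near(1)[OF x] by simp
    then have "?dT t (?f ?x) \<le> 1" using T.near(2)[OF t] v(2) by simp
    moreover have "(INF x\<in>graph_points V E. ?dT t (?f x)) \<le> ?dT t (?f ?x)"
      by (rule cINF_lower[OF _ x]) (auto intro!: bdd_belowI[of _ 0])
    ultimately show ?thesis by linarith
  qed
  have "?f \<in> graph_points V E \<rightarrow> graph_points tree_vertices tree_edges"
    by (intro Pi_I vertex_point_in rep_T near(1))
  moreover have "\<exists>L\<ge>1. \<exists>C>0. \<exists>D>0.
      (\<forall>p\<in>graph_points V E. \<forall>q\<in>graph_points V E.
        graph_dist V E p q / L - C \<le> ?dT (?f p) (?f q) \<and> ?dT (?f p) (?f q) \<le> L * graph_dist V E p q + C) \<and>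
      (\<forall>t\<in>graph_points tree_vertices tree_edges. (INF x\<in>graph_points V E. ?dT t (?f x)) \<le> D)"
    by (rule exI[of _ "real (K + 1)"], rule conjI, simp, (rule exI[of _ 1], rule conjI, simp)+,
        intro conjI ballI lower upper dense)
  ultimately show ?thesis unfolding quasi_isometry_def by (rule conjI)
qed

end

theorem corollary4p8:
  fixes V :: "'a set" and E :: "'a set set" and r m :: nat
  assumes "connected_graph V E"
    and "uniform_graph V E"
    and "2 \<le> r"
    and "\<And>a b S. a \<in> V \<Longrightarrow> b \<in> V \<Longrightarrow> minimal_r_separator V E r a b S \<Longrightarrow>
           vertex_diam V E (separator_side V E S a) \<le> of_nat m \<or>
           vertex_diam V E (separator_side V E S b) \<le> of_nat m"
  shows "bottleneck_property (graph_points V E) (graph_dist V E) \<and> quasi_isometric_to_tree V E"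
proof -
  interpret conn_graph V E by unfold_locales (rule assms(1))
  obtain base where "base \<in> V" using assms(1) by (auto simp: connected_graph_def)
  then interpret rooted_graph V E base by unfold_locales
  have "0 < r" using assms(3) by simp
  then have bottleneck: "\<exists>v\<in>component V E S x. hop z v \<le> m + r + 3"
    if "x \<in> V - S" "y \<in> component V E S x" "z \<in> V" "hop x z + hop z y \<le> hop x y + 3" for x y z S
    using vertex_bottleneck[OF assms(2) _ assms(4) that] by blast
  then have "bottleneck_property (graph_points V E) (graph_dist V E)"
    by (rule bottleneck_property_realization)
  moreover have "hop u v \<le> 6 * (m + r + 3) + 1" if "same_end u v" for u v
    using end_bounded[OF bottleneck that] .
  then have "quasi_isometric_to_tree V E"
    unfolding quasi_isometric_to_tree_def using tree quasi_isometry_to_tree by blast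
  ultimately show ?thesis by blast
qed

end
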